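(* One has $$d^\star(f;X)=\min\bigl\{\dim V:\ V\subset\mathbb{R}^n\text{ a linear subspace and there exists } M\ge0\text{ such that } MP_V-\nabla^2f(z)\succeq0\text{ for every }z\in\widehat X\bigr\}.$$ Moreover, whenever $(V,M)$ is feasible, i.e. $V$ is a subspace and $M\ge0$ with $MP_V-\nabla^2f(z)\succeq0$ for every $z\in\widehat X$, the functions $g(x)=\tfrac M2\|P_Vx\|^2$ and $h=g-f$ give a decomposition $(g,h)\in\mathcal{D}^2(f;X)$ whose first component has curvature confined to $V$, i.e. $V_X(g)\subset V$.
   Context: $X\subset\mathbb{R}^n$ is compact and full dimensional (its affine hull is $\mathbb{R}^n$), $\widehat X=\operatorname{conv}X$, and $f$ is a real-valued $C^2$ function on an open neighborhood of $\widehat X$. $\succeq$ denotes the Loewner order, and $P_V$ is the matrix of Euclidean orthogonal projection onto $V$. $\mathcal{D}^2(f;X)$ is the set of pairs $(g,h)$ of functions that are $C^2$ on a neighborhood of $\widehat X$, satisfy $f=g-h$ there, and are convex on $\widehat X$ (equivalently $\nabla^2 g(z)\succeq0$ and $\nabla^2h(z)\succeq0$ for all $z\in\widehat X$). For a $C^2$ convex $g$: $V_X(g)=\operatorname{span}\bigl(\bigcup_{z\in\widehat X}\operatorname{range}\nabla^2g(z)\bigr)$ and $d_X(g)=\dim V_X(g)$. The optimal dimension is $d^\star(f;X)=\min_{(g,h)\in\mathcal{D}^2(f;X)}d_X(g)$. *)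

theory Defs
  imports "HOL-Analysis.Analysis"
begin

definition gradient :: "(real^'n \<Rightarrow> real) \<Rightarrow> real^'n \<Rightarrow> real^'n" where
  "gradient f x = (\<chi> i. frechet_derivative f (at x) (axis i 1))"

definition hessian :: "(real^'n \<Rightarrow> real) \<Rightarrow> real^'n \<Rightarrow> real^'n^'n" where
  "hessian f x = jacobian (gradient f) (at x)"

text \<open>
  Functions are total in HOL, so a function given on an open set only is represented by an
  arbitrary total extension. Openness is required below, hence gradients and Hessians
  at points of the set do not depend on the extension.
\<close>

definition C2_on :: "(real^'n) set \<Rightarrow> (real^'n \<Rightarrow> real) \<Rightarrow> bool" where
  "C2_on U f \<longleftrightarrow> open U \<and> (\<forall>x\<in>U. f differentiable (at x)) \<and>
     (\<forall>x\<in>U. gradient f differentiable (at x)) \<and> continuous_on U (hessian f)"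

definition psd :: "real^'n^'n \<Rightarrow> bool" where
  "psd A \<longleftrightarrow> transpose A = A \<and> (\<forall>v. 0 \<le> v \<bullet> (A *v v))"

definition loewner_ge :: "real^'n^'n \<Rightarrow> real^'n^'n \<Rightarrow> bool" (infix "\<succeq>" 50) where
  "A \<succeq> B \<longleftrightarrow> psd (A - B)"

text \<open>On a linear subspace, the closest-point map is the orthogonal projection.\<close>

definition proj_matrix :: "(real^'n) set \<Rightarrow> real^'n^'n" where
  "proj_matrix V = matrix (closest_point V)"

definition DC2 :: "(real^'n \<Rightarrow> real) \<Rightarrow> (real^'n) set \<Rightarrow>
    ((real^'n \<Rightarrow> real) \<times> (real^'n \<Rightarrow> real)) set" where
  "DC2 f X = {(g, h). \<exists>W. convex hull X \<subseteq> W \<and> C2_on W g \<and> C2_on W h \<and>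
     (\<forall>x\<in>W. f x = g x - h x) \<and>
     convex_on (convex hull X) g \<and> convex_on (convex hull X) h}"

definition curv_space :: "(real^'n) set \<Rightarrow> (real^'n \<Rightarrow> real) \<Rightarrow> (real^'n) set" where
  "curv_space X g = span (\<Union>z\<in>convex hull X. range (\<lambda>v. hessian g z *v v))"

definition curv_dim :: "(real^'n) set \<Rightarrow> (real^'n \<Rightarrow> real) \<Rightarrow> nat" where
  "curv_dim X g = dim (curv_space X g)"

text \<open>
  The set of dimensions below is always finite, being bounded by the ambient dimension;
  \<open>Min\<close> is the minimum as soon as the set of decompositions is nonempty.
\<close>

definition opt_dim :: "(real^'n \<Rightarrow> real) \<Rightarrow> (real^'n) set \<Rightarrow> nat" where
  "opt_dim f X = Min {curv_dim X g | g h. (g, h) \<in> DC2 f X}"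

definition feasible :: "(real^'n \<Rightarrow> real) \<Rightarrow> (real^'n) set \<Rightarrow> (real^'n) set \<Rightarrow> real \<Rightarrow> bool" where
  "feasible f X V M \<longleftrightarrow> subspace V \<and> 0 \<le> M \<and>
     (\<forall>z\<in>convex hull X. M *\<^sub>R proj_matrix V - hessian f z \<succeq> 0)"

end

theory Submission
  imports Defs
begin

text \<open>
  If $g$ is convex, its Hessians are symmetric with range in $V = V_X(g)$, so
  $v \cdot \nabla^2 g(z) v = P_V v \cdot \nabla^2 g(z) P_V v \le M |P_V v|^2$ with $M$ a bound
  of the Hessian norm on the compact hull; subtracting the positive semidefinite $\nabla^2 h(z)$
  only helps, so $(V, M)$ is feasible. Conversely, a feasible $(V, M)$ makes the Hessian of
  $\frac{M}{2} |P_V x|^2 - f$ positive semidefinite on the hull, so this function is convex there.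
  Full dimensionality is what makes the Hessian of a function that is convex only on the hull
  positive semidefinite: this holds in the interior, hence on the hull by continuity.
\<close>

section \<open>Gradients and Hessians as derivatives\<close>

lemma has_derivative_gradient:
  fixes f :: "real^'n \<Rightarrow> real"
  assumes "f differentiable (at x)"
  shows "(f has_derivative (\<lambda>v. gradient f x \<bullet> v)) (at x)"
proof -
  let ?L = "frechet_derivative f (at x)"
  have d: "(f has_derivative ?L) (at x)"
    using assms by (simp add: frechet_derivative_works)
  then have l: "linear ?L"
    by (rule has_derivative_linear)
  have "?L v = gradient f x \<bullet> v" for v
  proof -
    have "?L v = ?L (\<Sum>i\<in>UNIV. v $ i *\<^sub>R axis i 1)"
      by (simp add: basis_expansion flip: scalar_mult_eq_scaleR)
    also have "\<dots> = (\<Sum>i\<in>UNIV. v $ i *\<^sub>R ?L (axis i 1))"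
      using l by (simp add: linear_sum linear_scale)
    finally show ?thesis
      by (simp add: gradient_def inner_vec_def mult.commute)
  qed
  then have "?L = (\<lambda>v. gradient f x \<bullet> v)" by blast
  with d show ?thesis by simp
qed

lemma gradient_unique:
  fixes f :: "real^'n \<Rightarrow> real"
  assumes "(f has_derivative (\<lambda>v. G \<bullet> v)) (at x)"
  shows "gradient f x = G"
proof -
  have "frechet_derivative f (at x) = (\<lambda>v. G \<bullet> v)"
    using frechet_derivative_at[OF assms] by simp
  then show ?thesis
    by (simp add: gradient_def vec_eq_iff inner_axis)
qed

lemma has_derivative_hessian:
  assumes "gradient f differentiable (at x)"
  shows "(gradient f has_derivative (\<lambda>v. hessian f x *v v)) (at x)"
  using assms by (simp add: hessian_def jacobian_works)

lemma hessian_unique: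
  assumes "(gradient f has_derivative (\<lambda>v. H *v v)) (at x)"
  shows "hessian f x = H"
proof -
  have "frechet_derivative (gradient f) (at x) = (\<lambda>v. H *v v)"
    using frechet_derivative_at[OF assms] by simp
  then show ?thesis
    by (simp add: hessian_def jacobian_def)
qed

text \<open>Since \<open>U\<close> is open, \<open>gradient f\<close> coincides with
  \<open>G\<close> near each point of \<open>U\<close>, so the derivative of \<open>G\<close> is
  that of \<open>gradient f\<close>. Membership in \<open>C2_on\<close> and the value of the Hessian
  thus follow from candidates checked on \<open>U\<close> only.\<close>

lemma C2_onI:
  assumes U: "open U"
    and f: "\<And>x. x \<in> U \<Longrightarrow> (f has_derivative (\<lambda>v. G x \<bullet> v)) (at x)"
    and G: "\<And>x. x \<in> U \<Longrightarrow> (G has_derivative (\<lambda>v. H x *v v)) (at x)"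
    and H: "continuous_on U H"
  shows "C2_on U f" and "\<And>x. x \<in> U \<Longrightarrow> hessian f x = H x"
proof -
  have gr: "gradient f x = G x" if "x \<in> U" for x
    using f[OF that] by (rule gradient_unique)
  have dG: "(gradient f has_derivative (\<lambda>v. H x *v v)) (at x)" if "x \<in> U" for x
    by (rule has_derivative_transform_within_open[OF G[OF that] U that]) (simp add: gr)
  then show he: "hessian f x = H x" if "x \<in> U" for x
    using that hessian_unique by blast
  have "continuous_on U (hessian f)"
    using H he by (simp cong: continuous_on_cong)
  with U f dG show "C2_on U f"
    unfolding C2_on_def differentiable_def by blast
qed

lemma C2_on_has_derivative:
  assumes "C2_on U f" "x \<in> U"
  shows "(f has_derivative (\<lambda>v. gradient f x \<bullet> v)) (at x)"
    and "(gradient f has_derivative (\<lambda>v. hessian f x *v v)) (at x)"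
  using assms has_derivative_gradient has_derivative_hessian
  unfolding C2_on_def by blast+

lemma C2_on_diff:
  assumes g: "C2_on U g" and h: "C2_on U h"
    and f: "\<And>x. x \<in> U \<Longrightarrow> f x = g x - h x"
  shows "C2_on U f" and "\<And>x. x \<in> U \<Longrightarrow> hessian f x = hessian g x - hessian h x"
proof -
  have U: "open U" using g by (simp add: C2_on_def)
  have 1: "(f has_derivative (\<lambda>v. (gradient g x - gradient h x) \<bullet> v)) (at x)" if "x \<in> U" for x
  proof -
    have "((\<lambda>x. g x - h x) has_derivative (\<lambda>v. (gradient g x - gradient h x) \<bullet> v)) (at x)"
      using has_derivative_diff[OF C2_on_has_derivative(1)[OF g that] C2_on_has_derivative(1)[OF h that]]
      by (simp add: inner_diff_left)
    then show ?thesis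
      by (rule has_derivative_transform_within_open[OF _ U that]) (simp add: f)
  qed
  have 2: "((\<lambda>x. gradient g x - gradient h x) has_derivative
      (\<lambda>v. (hessian g x - hessian h x) *v v)) (at x)" if "x \<in> U" for x
    using has_derivative_diff[OF C2_on_has_derivative(2)[OF g that] C2_on_has_derivative(2)[OF h that]]
    by (simp add: matrix_vector_mult_diff_rdistrib)
  have 3: "continuous_on U (\<lambda>x. hessian g x - hessian h x)"
    using g h by (intro continuous_intros) (auto simp: C2_on_def)
  show "C2_on U f" by (rule C2_onI(1)[OF U 1 2 3])
  show "\<And>x. x \<in> U \<Longrightarrow> hessian f x = hessian g x - hessian h x" by (rule C2_onI(2)[OF U 1 2 3])
qed

section \<open>Restriction to lines and symmetry of the Hessian\<close>

text \<open>The chain rule along a line. It carries the mean value theorem and the convexity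
  criteria of one variable over to \<open>real^'n\<close>.\<close>

lemma DERIV_along_line:
  assumes "C2_on U f" "x + t *\<^sub>R v \<in> U"
  shows "DERIV (\<lambda>t. f (x + t *\<^sub>R v)) t :> gradient f (x + t *\<^sub>R v) \<bullet> v"
    and "DERIV (\<lambda>t. gradient f (x + t *\<^sub>R v) \<bullet> w) t :> (hessian f (x + t *\<^sub>R v) *v v) \<bullet> w"
proof -
  have l: "((\<lambda>t. x + t *\<^sub>R v) has_derivative (\<lambda>s. s *\<^sub>R v)) (at t)"
    by (auto intro!: derivative_eq_intros)
  show "DERIV (\<lambda>t. f (x + t *\<^sub>R v)) t :> gradient f (x + t *\<^sub>R v) \<bullet> v"
    unfolding has_field_derivative_def
    by (rule has_derivative_eq_rhs[OF has_derivative_compose[OF l C2_on_has_derivative(1)[OF assms]]])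
      (simp add: fun_eq_iff)
  have "((\<lambda>t. gradient f (x + t *\<^sub>R v)) has_derivative
      (\<lambda>s. hessian f (x + t *\<^sub>R v) *v (s *\<^sub>R v))) (at t)"
    by (rule has_derivative_compose[OF l C2_on_has_derivative(2)[OF assms]])
  from has_derivative_inner_left[OF this, of w]
  show "DERIV (\<lambda>t. gradient f (x + t *\<^sub>R v) \<bullet> w) t :> (hessian f (x + t *\<^sub>R v) *v v) \<bullet> w"
    unfolding has_field_derivative_def
    by (rule has_derivative_eq_rhs) (simp add: fun_eq_iff matrix_vector_mult_scaleR)
qed

text \<open>The second difference is symmetric in $u$ and $v$ while its leading term a priori is not;
  this gives the symmetry of the Hessian.\<close>

lemma second_difference_bound:
  fixes f :: "real^'n \<Rightarrow> real"
  assumes C2: "C2_on U f" and x: "x \<in> U" and e: "e > 0"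
  shows "\<exists>d>0. \<forall>s. 0 < s \<and> s < d \<longrightarrow>
    \<bar>f (x + s *\<^sub>R u + s *\<^sub>R v) - f (x + s *\<^sub>R u) - f (x + s *\<^sub>R v) + f x
      - s\<^sup>2 * ((hessian f x *v v) \<bullet> u)\<bar> \<le> e * s\<^sup>2"
proof -
  let ?G = "gradient f" and ?H = "hessian f x"
  \<comment> \<open>\<open>s * K\<close> bounds every displacement from \<open>x\<close> by
    multiples of \<open>u\<close> and \<open>v\<close> with coefficients in [0, s]; the summand 1
    keeps \<open>K\<close> positive when both vectors vanish.\<close>
  define K where "K = norm u + norm v + 1"
  have K: "K > 0" "norm u \<le> K" unfolding K_def using norm_ge_zero[of u] norm_ge_zero[of v] by linarith+
  \<comment> \<open>Two gradient remainders of size at most \<open>e' * (s * K)\<close> occur below;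
    pairing them with \<open>u\<close> and multiplying by \<open>s\<close> costs a further factor
    \<open>s * K\<close>. The total is then exactly \<open>e * s\<^sup>2\<close>.\<close>
  define e' where "e' = e / (2 * K\<^sup>2)"
  have e': "e' > 0" using e K by (simp add: e'_def)
  obtain d1 where d1: "d1 > 0" "\<And>y. norm (y - x) < d1 \<Longrightarrow>
      norm (?G y - ?G x - ?H *v (y - x)) \<le> e' * norm (y - x)"
    using C2_on_has_derivative(2)[OF C2 x] e' unfolding has_derivative_at_alt by blast
  have "open U" using C2 by (simp add: C2_on_def)
  then obtain d2 where d2: "d2 > 0" "ball x d2 \<subseteq> U"
    using x by (meson openE)
  define d where "d = min d1 d2 / K"
  have "d > 0" using d1 d2 K by (simp add: d_def)
  moreover have "\<bar>f (x + s *\<^sub>R u + s *\<^sub>R v) - f (x + s *\<^sub>R u) - f (x + s *\<^sub>R v) + f x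
      - s\<^sup>2 * ((?H *v v) \<bullet> u)\<bar> \<le> e * s\<^sup>2" if s: "0 < s" "s < d" for s
  proof -
    have sK: "s * K < d1" "s * K < d2"
      using s K by (auto simp: d_def field_simps)
    have bnd: "norm (\<tau> *\<^sub>R u + \<sigma> *\<^sub>R v) \<le> s * K" if "0 \<le> \<tau>" "\<tau> \<le> s" "0 \<le> \<sigma>" "\<sigma> \<le> s" for \<tau> \<sigma>
    proof -
      have "norm (\<tau> *\<^sub>R u + \<sigma> *\<^sub>R v) \<le> \<tau> * norm u + \<sigma> * norm v"
        using norm_triangle_ineq[of "\<tau> *\<^sub>R u" "\<sigma> *\<^sub>R v"] that by simp
      also have "\<dots> \<le> s * norm u + s * norm v"
        using that by (intro add_mono mult_right_mono) auto
      also have "\<dots> \<le> s * K" using s by (simp add: K_def algebra_simps)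
      finally show ?thesis .
    qed
    have inU: "x + \<tau> *\<^sub>R u + \<sigma> *\<^sub>R v \<in> U" if "0 \<le> \<tau>" "\<tau> \<le> s" "0 \<le> \<sigma>" "\<sigma> \<le> s" for \<tau> \<sigma>
    proof -
      have "dist x (x + \<tau> *\<^sub>R u + \<sigma> *\<^sub>R v) = norm (\<tau> *\<^sub>R u + \<sigma> *\<^sub>R v)"
        using norm_minus_cancel[of "\<tau> *\<^sub>R u + \<sigma> *\<^sub>R v"] by (simp add: dist_norm algebra_simps)
      then show ?thesis using bnd[OF that] sK d2 by auto
    qed
    \<comment> \<open>The second difference is the increment over [0, s] of the map taking t to f(x
      + s v + t u) - f(x + t u), so the mean value theorem in direction \<open>u\<close>
      applies.\<close>
    have *: "\<exists>\<xi>>0. \<xi> < s \<and> (f ((x + s *\<^sub>R v) + s *\<^sub>R u) - f (x + s *\<^sub>R u)) -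
        (f ((x + s *\<^sub>R v) + 0 *\<^sub>R u) - f (x + 0 *\<^sub>R u)) =
        (s - 0) * (?G ((x + s *\<^sub>R v) + \<xi> *\<^sub>R u) \<bullet> u - ?G (x + \<xi> *\<^sub>R u) \<bullet> u)"
    proof (rule MVT2[OF s(1)], rule DERIV_diff)
      fix \<xi> assume "0 \<le> \<xi>" "\<xi> \<le> s"
      then have "(x + s *\<^sub>R v) + \<xi> *\<^sub>R u \<in> U" "x + \<xi> *\<^sub>R u \<in> U"
        using inU[of \<xi> s] inU[of \<xi> 0] s by (simp_all add: algebra_simps)
      then show "DERIV (\<lambda>t. f ((x + s *\<^sub>R v) + t *\<^sub>R u)) \<xi> :> ?G ((x + s *\<^sub>R v) + \<xi> *\<^sub>R u) \<bullet> u"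
        "DERIV (\<lambda>t. f (x + t *\<^sub>R u)) \<xi> :> ?G (x + \<xi> *\<^sub>R u) \<bullet> u"
        using DERIV_along_line(1)[OF C2] by blast+
    qed
    then obtain \<xi> where \<xi>: "0 < \<xi>" "\<xi> < s"
      and eq: "f (x + s *\<^sub>R u + s *\<^sub>R v) - f (x + s *\<^sub>R u) - f (x + s *\<^sub>R v) + f x =
        s * ((?G (x + \<xi> *\<^sub>R u + s *\<^sub>R v) - ?G (x + \<xi> *\<^sub>R u)) \<bullet> u)"
      by (auto simp: algebra_simps)
    \<comment> \<open>Both gradients are expanded at \<open>x\<close> itself, not at the
      intermediate point. Their difference is therefore s times the Hessian at \<open>x\<close>
      applied to \<open>v\<close>, plus a difference of two remainders.\<close>
    define R where "R y = ?G y - ?G x - ?H *v (y - x)" for y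
    have R: "norm (R (x + \<xi> *\<^sub>R u + \<sigma> *\<^sub>R v)) \<le> e' * (s * K)" if "0 \<le> \<sigma>" "\<sigma> \<le> s" for \<sigma>
    proof -
      have b: "norm ((x + \<xi> *\<^sub>R u + \<sigma> *\<^sub>R v) - x) \<le> s * K"
        using bnd[of \<xi> \<sigma>] \<xi> that by (simp add: algebra_simps)
      then have "norm (R (x + \<xi> *\<^sub>R u + \<sigma> *\<^sub>R v)) \<le> e' * norm ((x + \<xi> *\<^sub>R u + \<sigma> *\<^sub>R v) - x)"
        unfolding R_def using sK by (intro d1(2)) linarith
      also have "\<dots> \<le> e' * (s * K)" using b e' by (intro mult_left_mono) auto
      finally show ?thesis .
    qed
    let ?r = "R (x + \<xi> *\<^sub>R u + s *\<^sub>R v) - R (x + \<xi> *\<^sub>R u)"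
    have "?G (x + \<xi> *\<^sub>R u + s *\<^sub>R v) - ?G (x + \<xi> *\<^sub>R u) = s *\<^sub>R (?H *v v) + ?r"
      by (simp add: R_def matrix_vector_right_distrib matrix_vector_mult_diff_distrib
          matrix_vector_mult_scaleR algebra_simps)
    then have "f (x + s *\<^sub>R u + s *\<^sub>R v) - f (x + s *\<^sub>R u) - f (x + s *\<^sub>R v) + f x
        - s\<^sup>2 * ((?H *v v) \<bullet> u) = s * (?r \<bullet> u)"
      unfolding eq by (simp only: inner_add_left inner_scaleR_left) (simp add: power2_eq_square distrib_left)
    also have "\<bar>\<dots>\<bar> \<le> s * (norm ?r * norm u)"
      using s Cauchy_Schwarz_ineq2[of ?r u] by (simp add: abs_mult)
    also have "\<dots> \<le> s * ((2 * (e' * (s * K))) * K)"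
    proof -
      have "norm ?r \<le> 2 * (e' * (s * K))"
        using norm_triangle_ineq4[of "R (x + \<xi> *\<^sub>R u + s *\<^sub>R v)" "R (x + \<xi> *\<^sub>R u)"]
          R[of s] R[of 0] s by simp
      then show ?thesis using K s e' by (intro mult_left_mono mult_mono) auto
    qed
    also have "\<dots> = e * s\<^sup>2"
      using K by (simp add: e'_def power2_eq_square field_simps)
    finally show ?thesis .
  qed
  ultimately show ?thesis by blast
qed

text \<open>Symmetry is part of \<open>psd\<close> but not of \<open>C2_on\<close>. Exchanging
  \<open>u\<close> and \<open>v\<close> leaves the second difference unchanged, so both bilinear
  values approximate the same number.\<close>

lemma hessian_symmetric:
  fixes f :: "real^'n \<Rightarrow> real"
  assumes C2: "C2_on U f" and x: "x \<in> U"
  shows "transpose (hessian f x) = hessian f x"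
proof -
  have sym: "(hessian f x *v v) \<bullet> u = (hessian f x *v u) \<bullet> v" for u v
  proof (rule ccontr)
    let ?a = "(hessian f x *v v) \<bullet> u" and ?b = "(hessian f x *v u) \<bullet> v"
    assume "?a \<noteq> ?b"
    \<comment> \<open>The two estimates together give a gap of at most \<open>2 * e\<close>, which
      is half of the assumed positive gap.\<close>
    define e where "e = \<bar>?a - ?b\<bar> / 4"
    have e: "e > 0" using \<open>?a \<noteq> ?b\<close> by (simp add: e_def)
    obtain d1 where d1: "d1 > 0" "\<And>s. 0 < s \<Longrightarrow> s < d1 \<Longrightarrow>
      \<bar>f (x + s *\<^sub>R u + s *\<^sub>R v) - f (x + s *\<^sub>R u) - f (x + s *\<^sub>R v) + f x - s\<^sup>2 * ?a\<bar> \<le> e * s\<^sup>2"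
      using second_difference_bound[OF C2 x e, of u v] by blast
    obtain d2 where d2: "d2 > 0" "\<And>s. 0 < s \<Longrightarrow> s < d2 \<Longrightarrow>
      \<bar>f (x + s *\<^sub>R v + s *\<^sub>R u) - f (x + s *\<^sub>R v) - f (x + s *\<^sub>R u) + f x - s\<^sup>2 * ?b\<bar> \<le> e * s\<^sup>2"
      using second_difference_bound[OF C2 x e, of v u] by blast
    define s where "s = min d1 d2 / 2"
    have s: "0 < s" "s < d1" "s < d2" using d1 d2 by (auto simp: s_def)
    have "x + s *\<^sub>R v + s *\<^sub>R u = x + s *\<^sub>R u + s *\<^sub>R v" by (simp add: algebra_simps)
    with d1(2)[OF s(1,2)] d2(2)[OF s(1,3)] have "\<bar>s\<^sup>2 * ?a - s\<^sup>2 * ?b\<bar> \<le> 2 * (e * s\<^sup>2)"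
      by simp
    moreover have "\<bar>s\<^sup>2 * ?a - s\<^sup>2 * ?b\<bar> = s\<^sup>2 * \<bar>?a - ?b\<bar>"
      by (simp add: abs_mult flip: right_diff_distrib)
    ultimately have "s\<^sup>2 * \<bar>?a - ?b\<bar> \<le> s\<^sup>2 * (2 * e)"
      by (simp add: mult.left_commute mult.commute[of e])
    then have "\<bar>?a - ?b\<bar> \<le> 2 * e" using s by simp
    then show False using e by (simp add: e_def)
  qed
  have "transpose (hessian f x) *v v = hessian f x *v v" for v
  proof (rule vector_eq_rdot[THEN iffD1], rule allI)
    fix u
    show "(transpose (hessian f x) *v v) \<bullet> u = (hessian f x *v v) \<bullet> u"
      using sym[of v u] by (metis dot_lmul_matrix inner_commute transpose_matrix_vector)
  qed
  then show ?thesis by (simp add: matrix_eq)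
qed

section \<open>Convexity and positive semidefinite Hessians\<close>

lemma continuous_on_quadratic_form:
  fixes H :: "'a::topological_space \<Rightarrow> real^'n^'n"
  assumes "continuous_on S H"
  shows "continuous_on S (\<lambda>z. v \<bullet> (H z *v v))"
proof -
  have "linear (\<lambda>A :: real^'n^'n. v \<bullet> (A *v v))"
    by (rule linearI)
      (simp_all add: matrix_vector_mult_add_rdistrib inner_add_right flip: scaleR_matrix_vector_assoc)
  then show ?thesis
    using continuous_on_compose2[OF linear_continuous_on[OF linear_conv_bounded_linear[THEN iffD1]] assms]
    by blast
qed

text \<open>Along a line, the slope of a convex function is nondecreasing. A negative quadratic form
  would be a negative derivative of that slope at 0, forcing it to drop just to the right of
  0.\<close>

lemma convex_on_interior_imp_hessian_nonneg:
  fixes g :: "real^'n \<Rightarrow> real"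
  assumes C2: "C2_on W g" and CW: "C \<subseteq> W" and cv: "convex_on C g" and x: "x \<in> interior C"
  shows "0 \<le> v \<bullet> (hessian g x *v v)"
proof (rule ccontr)
  assume neg: "\<not> 0 \<le> v \<bullet> (hessian g x *v v)"
  obtain r where r: "r > 0" "ball x r \<subseteq> C"
    using x by (meson mem_interior)
  \<comment> \<open>Adding 1 to the norm covers \<open>v = 0\<close>; for |t| < \<delta> the point x
    + t v stays in the ball.\<close>
  define \<delta> where "\<delta> = r / (norm v + 1)"
  have nv: "norm v + 1 > 0" using norm_ge_zero[of v] by linarith
  have \<delta>: "\<delta> > 0" using r nv by (simp add: \<delta>_def)
  let ?I = "{-\<delta><..<\<delta>}"
  have inC: "x + t *\<^sub>R v \<in> C" if "t \<in> ?I" for t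
  proof -
    have "\<bar>t\<bar> * norm v \<le> \<bar>t\<bar> * (norm v + 1)" by (simp add: algebra_simps)
    also have "\<dots> < \<delta> * (norm v + 1)"
      using that nv by (intro mult_strict_right_mono) auto
    also have "\<dots> = r" using nv by (simp add: \<delta>_def)
    finally show ?thesis using r by (auto simp: dist_norm subset_iff)
  qed
  define \<phi> where "\<phi> t = g (x + t *\<^sub>R v)" for t
  define \<phi>' where "\<phi>' t = gradient g (x + t *\<^sub>R v) \<bullet> v" for t
  have D1: "DERIV \<phi> t :> \<phi>' t" if "t \<in> ?I" for t
    unfolding \<phi>_def \<phi>'_def using DERIV_along_line(1)[OF C2] inC[OF that] CW by blast
  have "DERIV \<phi>' 0 :> (hessian g (x + 0 *\<^sub>R v) *v v) \<bullet> v"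
    unfolding \<phi>'_def using inC[of 0] CW \<delta> by (intro DERIV_along_line(2)[OF C2]) auto
  then have "DERIV \<phi>' 0 :> v \<bullet> (hessian g x *v v)"
    by (simp add: inner_commute)
  then obtain d where d: "d > 0" "\<And>h. h > 0 \<Longrightarrow> h < d \<Longrightarrow> \<phi>' (0 + h) < \<phi>' 0"
    using DERIV_neg_dec_right neg by (metis not_le)
  have conv: "convex_on ?I \<phi>"
  proof (rule convex_onI)
    fix t a b :: real
    assume t: "0 < t" "t < 1" and "a \<in> ?I" "b \<in> ?I"
    have "x + ((1 - t) *\<^sub>R a + t *\<^sub>R b) *\<^sub>R v = (1 - t) *\<^sub>R (x + a *\<^sub>R v) + t *\<^sub>R (x + b *\<^sub>R v)"
      by (simp add: algebra_simps)
    then show "\<phi> ((1 - t) *\<^sub>R a + t *\<^sub>R b) \<le> (1 - t) * \<phi> a + t * \<phi> b"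
      unfolding \<phi>_def
      using convex_onD[OF cv, of t "x + a *\<^sub>R v" "x + b *\<^sub>R v"] t inC \<open>a \<in> ?I\<close> \<open>b \<in> ?I\<close> by simp
  qed simp
  have tangent: "\<phi> b - \<phi> a \<ge> \<phi>' a * (b - a)" if "a \<in> ?I" "b \<in> ?I" for a b
    using that D1[OF that(1)] by (intro convex_on_imp_above_tangent[OF conv])
      (auto intro: has_field_derivative_at_within simp: interior_open)
  define t where "t = min d \<delta> / 2"
  have t: "0 < t" "t < d" "t \<in> ?I" using d \<delta> by (auto simp: t_def)
  \<comment> \<open>Tangents at 0 and at t both lie below the graph; adding the two inequalities
    cancels the values of \<phi> and compares the slopes.\<close>
  have "\<phi>' 0 * (t - 0) \<le> \<phi> t - \<phi> 0" "\<phi>' t * (0 - t) \<le> \<phi> 0 - \<phi> t"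
    using \<delta> t(3) by (intro tangent; simp)+
  then have "\<phi>' 0 * t \<le> \<phi>' t * t" by simp
  then have "\<phi>' 0 \<le> \<phi>' t" using t by simp
  then show False using d(2)[OF t(1,2)] by simp
qed

lemma convex_on_imp_psd_hessian:
  fixes g :: "real^'n \<Rightarrow> real"
  assumes C2: "C2_on W g" and CW: "C \<subseteq> W" and cv: "convex_on C g"
    and C: "closed C" "interior C \<noteq> {}" and z: "z \<in> C"
  shows "psd (hessian g z)"
proof -
  have "convex C" using cv by (rule convex_on_imp_convex)
  \<comment> \<open>Every boundary point is thus a limit of interior points, and for fixed
    \<open>v\<close> nonnegativity of the continuous quadratic form passes to the limit.\<close>
  then have cl: "closure (interior C) = C"
    using C by (simp add: convex_closure_interior)
  have "continuous_on C (hessian g)"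
    using C2 CW unfolding C2_on_def by (blast intro: continuous_on_subset)
  then have "0 \<le> v \<bullet> (hessian g z *v v)" for v
    using continuous_ge_on_closure[of "interior C" "\<lambda>z. v \<bullet> (hessian g z *v v)" z 0]
      continuous_on_quadratic_form[of C "hessian g" v]
      convex_on_interior_imp_hessian_nonneg[OF C2 CW cv] cl z by auto
  then show ?thesis
    using hessian_symmetric[OF C2] z CW by (auto simp: psd_def)
qed

text \<open>On a segment within \<open>C\<close> the second derivative is the quadratic form of the
  Hessian in the direction of the segment, so the second derivative test on [0, 1] suffices.\<close>

lemma psd_hessian_imp_convex_on:
  fixes h :: "real^'n \<Rightarrow> real"
  assumes C2: "C2_on W h" and CW: "C \<subseteq> W" and C: "convex C"
    and psd: "\<And>z. z \<in> C \<Longrightarrow> psd (hessian h z)"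
  shows "convex_on C h"
proof (rule convex_onI[OF _ C])
  fix t x y
  assume t: "0 < t" "t < (1::real)" and xy: "x \<in> C" "y \<in> C"
  define v where "v = y - x"
  have inC: "x + s *\<^sub>R v \<in> C" if "s \<in> {0..1}" for s
  proof -
    have "x + s *\<^sub>R v = (1 - s) *\<^sub>R x + s *\<^sub>R y" by (simp add: v_def algebra_simps)
    then show ?thesis using convexD[OF C xy, of "1 - s" s] that by simp
  qed
  have "convex_on {0..1} (\<lambda>s. h (x + s *\<^sub>R v))"
  proof (rule f''_ge0_imp_convex)
    fix s :: real
    assume s: "s \<in> {0..1}"
    show "DERIV (\<lambda>s. h (x + s *\<^sub>R v)) s :> gradient h (x + s *\<^sub>R v) \<bullet> v"
      "DERIV (\<lambda>s. gradient h (x + s *\<^sub>R v) \<bullet> v) s :> (hessian h (x + s *\<^sub>R v) *v v) \<bullet> v"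
      using DERIV_along_line[OF C2] inC[OF s] CW by blast+
    show "0 \<le> (hessian h (x + s *\<^sub>R v) *v v) \<bullet> v"
      using psd[OF inC[OF s]] by (simp add: psd_def inner_commute)
  qed simp
  from convex_onD[OF this, of t 0 1] t
  have "h (x + t *\<^sub>R v) \<le> (1 - t) * h x + t * h (x + v)" by simp
  moreover have "x + t *\<^sub>R v = (1 - t) *\<^sub>R x + t *\<^sub>R y" "x + v = y"
    by (simp_all add: v_def algebra_simps)
  ultimately show "h ((1 - t) *\<^sub>R x + t *\<^sub>R y) \<le> (1 - t) * h x + t * h y" by simp
qed

section \<open>The matrix of the orthogonal projection\<close>

text \<open>These two properties characterize the orthogonal projection; the later facts about
  \<open>proj_matrix\<close> are derived from them and not from closest points.\<close>

lemma proj_matrix_decomp: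
  fixes V :: "(real^'n) set"
  assumes V: "subspace V"
  shows "proj_matrix V *v x \<in> V" and "w \<in> V \<Longrightarrow> (x - proj_matrix V *v x) \<bullet> w = 0"
proof -
  have span: "span V = V" using V by (simp add: span_eq_iff)
  \<comment> \<open>By Pythagoras, a point of \<open>V\<close> with residual orthogonal to
    \<open>V\<close> is the closest one. Uniqueness of the closest point then identifies it.\<close>
  have cp: "closest_point V x = y" if "y \<in> V" "\<And>w. w \<in> V \<Longrightarrow> (x - y) \<bullet> w = 0" for x y
  proof (rule closest_point_unique[symmetric])
    show "convex V" "closed V" "y \<in> V"
      using V that by (auto simp: subspace_imp_convex closed_subspace)
    show "\<forall>z\<in>V. dist x y \<le> dist x z"
    proof
      fix z assume "z \<in> V"
      then have "orthogonal (x - y) (y - z)"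
        using that V by (simp add: orthogonal_def subspace_diff)
      then have "(norm (x - z))\<^sup>2 = (norm (x - y))\<^sup>2 + (norm (y - z))\<^sup>2"
        using norm_add_Pythagorean[of "x - y" "y - z"] by simp
      then have "(norm (x - y))\<^sup>2 \<le> (norm (x - z))\<^sup>2" by simp
      then show "dist x y \<le> dist x z"
        unfolding dist_norm by (rule power2_le_imp_le) simp
    qed
  qed
  have ex: "\<exists>y\<in>V. \<forall>w\<in>V. (x - y) \<bullet> w = 0" for x
  proof -
    obtain y z where "y \<in> span V" "\<And>w. w \<in> span V \<Longrightarrow> orthogonal z w" "x = y + z"
      using orthogonal_subspace_decomp_exists[of V x] by blast
    then show ?thesis unfolding span orthogonal_def by (intro bexI[of _ y]) auto
  qed
  have c: "closest_point V x \<in> V" "w \<in> V \<Longrightarrow> (x - closest_point V x) \<bullet> w = 0" for x w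
    using ex[of x] cp by metis+
  \<comment> \<open>\<open>matrix\<close> represents a map only if the map is linear. Sums and
    multiples of projections again satisfy the criterion \<open>cp\<close>, which yields
    linearity.\<close>
  have lin: "linear (closest_point V)"
  proof (rule linearI)
    show "closest_point V (a + b) = closest_point V a + closest_point V b" for a b
      using c(1)[of a] c(1)[of b] c(2)[of _ a] c(2)[of _ b] V
      by (intro cp) (auto intro: subspace_add simp: inner_diff_left inner_add_left)
    show "closest_point V (r *\<^sub>R b) = r *\<^sub>R closest_point V b" for r b
      using c(1)[of b] c(2)[of _ b] V
      by (intro cp) (auto intro: subspace_scale simp: inner_diff_left)
  qed
  have "proj_matrix V *v x = closest_point V x"
    unfolding proj_matrix_def using lin by (simp add: matrix_works)
  then show "proj_matrix V *v x \<in> V" "w \<in> V \<Longrightarrow> (x - proj_matrix V *v x) \<bullet> w = 0"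
    using c by simp_all
qed

text \<open>The residual of \<open>y\<close> is orthogonal to the projection of \<open>x\<close>. As
  the right-hand side is symmetric in \<open>x\<close> and \<open>y\<close>, the projection matrix
  is symmetric; \<open>x = y\<close> gives its quadratic form.\<close>

lemma proj_matrix_inner:
  assumes "subspace V"
  shows "(proj_matrix V *v x) \<bullet> y = (proj_matrix V *v x) \<bullet> (proj_matrix V *v y)"
  using proj_matrix_decomp(2)[OF assms proj_matrix_decomp(1)[OF assms], of y x]
  by (simp add: inner_diff_left inner_commute[of "proj_matrix V *v x"])

lemma transpose_proj_matrix:
  assumes V: "subspace V"
  shows "transpose (proj_matrix V) = proj_matrix V"
proof -
  have "transpose (proj_matrix V) *v v = proj_matrix V *v v" for v
  proof (rule vector_eq_rdot[THEN iffD1], rule allI)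
    fix u
    show "(transpose (proj_matrix V) *v v) \<bullet> u = (proj_matrix V *v v) \<bullet> u"
      using proj_matrix_inner[OF V, of u v] proj_matrix_inner[OF V, of v u]
      by (metis dot_lmul_matrix inner_commute transpose_matrix_vector)
  qed
  then show ?thesis by (simp add: matrix_eq)
qed

text \<open>For the whole space the residual is orthogonal to itself, hence zero.\<close>

lemma proj_matrix_UNIV: "proj_matrix UNIV *v x = x"
  using proj_matrix_decomp(2)[of UNIV "x - proj_matrix UNIV *v x" x]
  by (simp add: subspace_UNIV)

lemma transpose_diff: "transpose (A - B :: real^'n^'m) = transpose A - transpose B"
  by (simp add: transpose_def vec_eq_iff)

lemma transpose_scaleR: "transpose (c *\<^sub>R A :: real^'n^'m) = c *\<^sub>R transpose A"
  by (simp add: transpose_def vec_eq_iff)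

lemma scaleR_proj_quadratic:
  assumes "subspace V"
  shows "v \<bullet> ((M *\<^sub>R proj_matrix V) *v v) = M * (norm (proj_matrix V *v v))\<^sup>2"
  using proj_matrix_inner[OF assms, of v v]
  by (simp add: inner_commute power2_norm_eq_inner flip: scaleR_matrix_vector_assoc)

text \<open>The function is half the quadratic form of the symmetric matrix A = M P_V, so its
  gradient is A x and its Hessian the constant A.\<close>

lemma C2_on_proj_quadratic:
  fixes V U :: "(real^'n) set" and M :: real
  assumes V: "subspace V" and U: "open U"
  defines "g \<equiv> \<lambda>x. M / 2 * (norm (proj_matrix V *v x))\<^sup>2"
  shows "C2_on U g" and "\<And>x. x \<in> U \<Longrightarrow> hessian g x = M *\<^sub>R proj_matrix V"
proof -
  let ?A = "M *\<^sub>R proj_matrix V"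
  have g: "g x = (x \<bullet> (?A *v x)) / 2" for x
    by (simp add: g_def scaleR_proj_quadratic[OF V])
  have sym: "x \<bullet> (?A *v v) = (?A *v x) \<bullet> v" for x v
    using transpose_proj_matrix[OF V]
    by (metis dot_lmul_matrix transpose_matrix_vector transpose_scaleR)
  have A: "((\<lambda>x. ?A *v x) has_derivative (\<lambda>v. ?A *v v)) (at x)" for x
    by (intro bounded_linear_imp_has_derivative matrix_vector_mul_bounded_linear)
  have 1: "(g has_derivative (\<lambda>v. (?A *v x) \<bullet> v)) (at x)" for x
  proof -
    have "((\<lambda>x. x \<bullet> (?A *v x)) has_derivative (\<lambda>v. x \<bullet> (?A *v v) + v \<bullet> (?A *v x))) (at x)"
      by (rule has_derivative_inner[OF has_derivative_ident A])
    then have "((\<lambda>x. (x \<bullet> (?A *v x)) / 2) has_derivative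
        (\<lambda>v. (x \<bullet> (?A *v v) + v \<bullet> (?A *v x)) / 2)) (at x)"
      by (rule bounded_linear.has_derivative[OF bounded_linear_divide])
    then show ?thesis
      unfolding g[abs_def] by (rule has_derivative_eq_rhs) (simp add: sym[of x] inner_commute[of _ "?A *v x"])
  qed
  show "C2_on U g" by (rule C2_onI(1)[OF U 1 A continuous_on_const])
  show "\<And>x. x \<in> U \<Longrightarrow> hessian g x = ?A" by (rule C2_onI(2)[OF U 1 A continuous_on_const])
qed

section \<open>Bounds for quadratic forms\<close>

text \<open>On \<open>real^'n^'m\<close> the library norm is the Frobenius norm, the Euclidean norm
  of the row norms; Cauchy-Schwarz applies to each row.\<close>

lemma norm_matrix_vector_mult_le: "norm (A *v v) \<le> norm A * norm (v :: real^'n)"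
proof -
  have "norm (A *v v) = L2_set (\<lambda>i. \<bar>A $ i \<bullet> v\<bar>) UNIV"
    by (simp add: norm_vec_def matrix_vector_mult_def inner_vec_def)
  also have "\<dots> \<le> L2_set (\<lambda>i. norm (A $ i) * norm v) UNIV"
    by (intro L2_set_mono) (auto simp: Cauchy_Schwarz_ineq2)
  also have "\<dots> = norm A * norm v"
    by (simp add: norm_vec_def L2_set_left_distrib)
  finally show ?thesis .
qed

lemma quadratic_form_le_norm: "v \<bullet> (A *v v) \<le> norm A * (norm (v :: real^'n))\<^sup>2"
proof -
  have "v \<bullet> (A *v v) \<le> norm v * norm (A *v v)" by (rule norm_cauchy_schwarz)
  also have "\<dots> \<le> norm v * (norm A * norm v)"
    by (intro mult_left_mono norm_matrix_vector_mult_le) simp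
  finally show ?thesis by (simp add: power2_eq_square algebra_simps)
qed

text \<open>A symmetric matrix with range in \<open>V\<close> annihilates the orthogonal complement
  of \<open>V\<close>, so both arguments may be replaced by their projections.\<close>

lemma quadratic_form_confined:
  fixes A :: "real^'n^'n"
  assumes V: "subspace V" and A: "transpose A = A" and ran: "\<And>v. A *v v \<in> V"
  shows "v \<bullet> (A *v v) = (proj_matrix V *v v) \<bullet> (A *v (proj_matrix V *v v))"
proof -
  let ?p = "proj_matrix V *v v"
  have sym: "x \<bullet> (A *v y) = (A *v x) \<bullet> y" for x y
    by (metis A dot_lmul_matrix transpose_matrix_vector)
  have d: "v \<bullet> (A *v w) = ?p \<bullet> (A *v w)" for w
    using proj_matrix_decomp(2)[OF V ran[of w], of v] by (simp add: inner_diff_left)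
  have "v \<bullet> (A *v v) = v \<bullet> (A *v ?p)"
    using d[of v] sym by (metis inner_commute)
  with d[of ?p] show ?thesis by simp
qed

lemma compact_norm_hessian_bounded:
  assumes "compact C" "C \<subseteq> W" "C2_on W g"
  obtains M where "0 \<le> M" "\<And>z. z \<in> C \<Longrightarrow> norm (hessian g z) \<le> M"
proof -
  have "continuous_on C (hessian g)"
    using assms unfolding C2_on_def by (blast intro: continuous_on_subset)
  then have "bounded (hessian g ` C)"
    using assms by (simp add: compact_continuous_image compact_imp_bounded)
  then obtain M where "M > 0" "\<forall>z\<in>hessian g ` C. norm z \<le> M"
    by (meson bounded_pos)
  then show ?thesis using that[of M] by auto
qed

section \<open>Passing between decompositions and feasible pairs\<close>

text \<open>Every dimension attained by a decomposition is thereby attained by a feasible subspace.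
  The constant \<open>M\<close> may depend on the decomposition.\<close>

lemma feasible_curv_space:
  fixes X U :: "(real^'n) set"
  assumes X: "compact X" "affine hull X = UNIV" and U: "convex hull X \<subseteq> U" "C2_on U f"
    and gh: "(g, h) \<in> DC2 f X"
  shows "\<exists>M. feasible f X (curv_space X g) M"
proof -
  let ?C = "convex hull X" and ?V = "curv_space X g"
  have "affine hull ?C = UNIV" using X by simp
  \<comment> \<open>With affine hull \<open>UNIV\<close> the relative interior is the interior, and
    a nonempty convex set has nonempty relative interior. The hull is nonempty because the empty set
    has empty affine hull.\<close>
  then have int: "interior ?C \<noteq> {}"
    by (metis UNIV_not_empty affine_hull_empty convex_convex_hull rel_interior_eq_empty rel_interior_interior)
  have C: "compact ?C" "closed ?C"
    using X by (simp_all add: compact_convex_hull compact_imp_closed)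
  obtain W where W: "?C \<subseteq> W" "C2_on W g" "C2_on W h" "\<And>x. x \<in> W \<Longrightarrow> f x = g x - h x"
    and cv: "convex_on ?C g" "convex_on ?C h"
    using gh unfolding DC2_def by auto
  have hess: "hessian f z = hessian g z - hessian h z" if "z \<in> ?C" for z
    using C2_on_diff(2)[OF W(2,3,4)] W(1) that by blast
  obtain M where M: "0 \<le> M" "\<And>z. z \<in> ?C \<Longrightarrow> norm (hessian g z) \<le> M"
    using compact_norm_hessian_bounded[OF C(1) W(1,2)] by blast
  have V: "subspace ?V" by (simp add: curv_space_def)
  have "psd (M *\<^sub>R proj_matrix ?V - hessian f z)" if z: "z \<in> ?C" for z
    unfolding psd_def
  proof (intro conjI allI)
    show "transpose (M *\<^sub>R proj_matrix ?V - hessian f z) = M *\<^sub>R proj_matrix ?V - hessian f z"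
      using hessian_symmetric[OF U(2)] U(1) z
      by (auto simp: transpose_diff transpose_scaleR transpose_proj_matrix[OF V])
    fix v
    let ?p = "proj_matrix ?V *v v"
    have ran: "hessian g z *v w \<in> ?V" for w
      unfolding curv_space_def using z by (intro span_base) auto
    have "transpose (hessian g z) = hessian g z"
      using hessian_symmetric[OF W(2)] W(1) z by blast
    then have "v \<bullet> (hessian g z *v v) = ?p \<bullet> (hessian g z *v ?p)"
      using quadratic_form_confined[OF V _ ran] by blast
    also have "\<dots> \<le> norm (hessian g z) * (norm ?p)\<^sup>2"
      by (rule quadratic_form_le_norm)
    also have "\<dots> \<le> M * (norm ?p)\<^sup>2"
      using M(2)[OF z] by (intro mult_right_mono) auto
    finally have "v \<bullet> (hessian g z *v v) \<le> v \<bullet> ((M *\<^sub>R proj_matrix ?V) *v v)"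
      by (simp add: scaleR_proj_quadratic[OF V])
    moreover have "0 \<le> v \<bullet> (hessian h z *v v)"
      using convex_on_imp_psd_hessian[OF W(3,1) cv(2) C(2) int z] by (simp add: psd_def)
    ultimately show "0 \<le> v \<bullet> ((M *\<^sub>R proj_matrix ?V - hessian f z) *v v)"
      by (simp add: hess[OF z] matrix_vector_mult_diff_rdistrib inner_diff_right)
  qed
  then show ?thesis using V M(1) by (auto simp: feasible_def loewner_ge_def)
qed

text \<open>Here the projection is the identity, so a bound of the Hessian norm on the compact hull
  serves as \<open>M\<close>. This feasible pair, and the decomposition built from it, show that
  both minima range over nonempty sets.\<close>

lemma feasible_UNIV:
  fixes X U :: "(real^'n) set"
  assumes X: "compact X" and U: "convex hull X \<subseteq> U" "C2_on U f"
  shows "\<exists>M. feasible f X UNIV M"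
proof -
  obtain M where M: "0 \<le> M" "\<And>z. z \<in> convex hull X \<Longrightarrow> norm (hessian f z) \<le> M"
    using compact_norm_hessian_bounded[OF compact_convex_hull[OF X] U] by blast
  have "psd (M *\<^sub>R proj_matrix UNIV - hessian f z)" if z: "z \<in> convex hull X" for z
    unfolding psd_def
  proof (intro conjI allI)
    show "transpose (M *\<^sub>R proj_matrix UNIV - hessian f z) = M *\<^sub>R proj_matrix UNIV - hessian f z"
      using hessian_symmetric[OF U(2)] U(1) z
      by (auto simp: transpose_diff transpose_scaleR transpose_proj_matrix subspace_UNIV)
    fix v
    have "v \<bullet> (hessian f z *v v) \<le> M * (norm v)\<^sup>2"
      using quadratic_form_le_norm[of v "hessian f z"] M(2)[OF z]
      by (meson mult_right_mono order_trans zero_le_power2)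
    then show "0 \<le> v \<bullet> ((M *\<^sub>R proj_matrix UNIV - hessian f z) *v v)"
      by (simp add: matrix_vector_mult_diff_rdistrib inner_diff_right
          scaleR_proj_quadratic subspace_UNIV proj_matrix_UNIV)
  qed
  then show ?thesis using M(1) by (auto simp: feasible_def loewner_ge_def subspace_UNIV)
qed

text \<open>The Hessian of \<open>g\<close> is M P_V everywhere on \<open>U\<close>, so the Hessian
  of g - f on the hull is exactly the matrix that feasibility declares positive
  semidefinite.\<close>

lemma feasible_decomposition:
  fixes X U :: "(real^'n) set"
  assumes U: "convex hull X \<subseteq> U" "C2_on U f" and feas: "feasible f X V M"
  defines "g \<equiv> \<lambda>x. M / 2 * (norm (proj_matrix V *v x))\<^sup>2"
  shows "(g, \<lambda>x. g x - f x) \<in> DC2 f X" and "curv_space X g \<subseteq> V"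
proof -
  let ?C = "convex hull X" and ?h = "\<lambda>x. g x - f x"
  have V: "subspace V" and M: "0 \<le> M"
    and psd: "\<And>z. z \<in> ?C \<Longrightarrow> psd (M *\<^sub>R proj_matrix V - hessian f z)"
    using feas by (auto simp: feasible_def loewner_ge_def)
  have "open U" using U by (simp add: C2_on_def)
  note C2g = C2_on_proj_quadratic[OF V this, where M = M, folded g_def]
  have C2h: "C2_on U ?h" and hess: "\<And>x. x \<in> U \<Longrightarrow> hessian ?h x = hessian g x - hessian f x"
    \<comment> \<open>The difference rule is used with \<open>?h\<close> as the difference of
      \<open>g\<close> and \<open>f\<close>.\<close>
    using C2_on_diff[OF C2g(1) U(2), of ?h] by auto
  have "psd (M *\<^sub>R proj_matrix V)"
    using M by (simp add: psd_def transpose_scaleR transpose_proj_matrix[OF V] scaleR_proj_quadratic[OF V])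
  then have "convex_on ?C g"
    using U C2g by (intro psd_hessian_imp_convex_on[OF C2g(1)]) auto
  moreover have "convex_on ?C ?h"
    using U C2g hess psd by (intro psd_hessian_imp_convex_on[OF C2h]) (auto simp: subset_iff)
  ultimately show "(g, ?h) \<in> DC2 f X"
    unfolding DC2_def using U C2g C2h by auto
  have "hessian g z *v v \<in> V" if "z \<in> ?C" for z v
    using C2g(2) U that proj_matrix_decomp(1)[OF V] subspace_scale[OF V]
    by (auto simp flip: scaleR_matrix_vector_assoc)
  then show "curv_space X g \<subseteq> V"
    unfolding curv_space_def using V by (intro span_minimal) auto
qed

text \<open>The two existence claims accompany the equation because \<open>Min\<close> is a genuine
  minimum only over a nonempty finite set.\<close>

theorem proposition3p2:
  fixes X U :: "(real^'n) set" and f :: "real^'n \<Rightarrow> real"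
  assumes "compact X" and "affine hull X = UNIV"
    and "convex hull X \<subseteq> U" and "C2_on U f"
  shows "(DC2 f X \<noteq> {} \<and> (\<exists>V M. feasible f X V M) \<and>
          opt_dim f X = Min {dim V | V. subspace V \<and> (\<exists>M. feasible f X V M)}) \<and>
         (\<forall>V M. feasible f X V M \<longrightarrow>
           (let g = (\<lambda>x. M / 2 * (norm (proj_matrix V *v x))\<^sup>2);
                h = (\<lambda>x. g x - f x)
            in (g, h) \<in> DC2 f X \<and> curv_space X g \<subseteq> V))"
proof -
  note dec = feasible_decomposition[OF assms(3,4)]
  obtain M0 where M0: "feasible f X UNIV M0"
    using feasible_UNIV[OF assms(1,3,4)] by blast
  let ?D = "{curv_dim X g | g h. (g, h) \<in> DC2 f X}"
  let ?E = "{dim V | V. subspace V \<and> (\<exists>M. feasible f X V M)}"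
  have sub: "?D \<subseteq> ?E"
  proof
    fix d assume "d \<in> ?D"
    then obtain g h where gh: "(g, h) \<in> DC2 f X" "d = curv_dim X g" by blast
    then show "d \<in> ?E"
      using feasible_curv_space[OF assms gh(1)] by (auto simp: curv_dim_def feasible_def)
  qed
  \<comment> \<open>Only an inequality is available: the curvature space may be a proper subspace of
    \<open>V\<close>, for instance when \<open>M = 0\<close> and \<open>V\<close> is nontrivial.
    Together with \<open>sub\<close> this still forces equal minima.\<close>
  have dom: "\<exists>d\<in>?D. d \<le> e" if "e \<in> ?E" for e
  proof -
    obtain V M where VM: "feasible f X V M" "e = dim V" using \<open>e \<in> ?E\<close> by blast
    show ?thesis
      using dec[OF VM(1)] VM(2) dim_subset unfolding curv_dim_def by blast
  qed
  \<comment> \<open>The ambient dimension bounds \<open>?E\<close>; finiteness then passes to the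
    subset \<open>?D\<close>.\<close>
  have "e \<le> DIM(real^'n)" if "e \<in> ?E" for e
    using that dim_subset_UNIV by blast
  then have "?E \<subseteq> {..DIM(real^'n)}" by blast
  then have finE: "finite ?E" by (rule finite_subset) simp
  then have finD: "finite ?D" using sub by (rule rev_finite_subset)
  have D: "?D \<noteq> {}" using dec[OF M0] by blast
  then have E: "?E \<noteq> {}" using sub by blast
  have "Min ?D = Min ?E"
  proof (rule antisym)
    show "Min ?E \<le> Min ?D" by (rule Min_antimono[OF sub D finE])
    show "Min ?D \<le> Min ?E"
      using dom[OF Min_in[OF finE E]] finD by (meson Min_le order_trans)
  qed
  then show ?thesis
    using D M0 dec unfolding opt_dim_def Let_def by blast
qed

end
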